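(* Let $I\subseteq L_{16}$ be a nonempty subset and let $\rho_I$ be the corresponding lattice state. If there exists a point $(\alpha_0,\beta_0)\in I$ such that no special quadruple containing $(\alpha_0,\beta_0)$ is contained in $I$, then $\rho_I$ is entangled.
   Context: $\sigma_0=\mathbb{1}_2$, $\sigma_1,\sigma_2,\sigma_3$ are the Pauli matrices, $\sigma_{\alpha\beta}=\sigma_\alpha\otimes\sigma_\beta\in M_4(\mathbb{C})$, and $L_{16}=\{(\alpha,\beta):\alpha,\beta\in\{0,1,2,3\}\}$. Let $|\Psi_+\rangle=\frac12\sum_{j=1}^4|j\rangle\otimes|j\rangle\in\mathbb{C}^4\otimes\mathbb{C}^4$ and let $P_{\alpha\beta}$ be the orthogonal projection onto $(\mathbb{1}_4\otimes\sigma_{\alpha\beta})|\Psi_+\rangle$. For nonempty $I\subseteq L_{16}$ with $N_I$ elements the lattice state is $\rho_I=\frac1{N_I}\sum_{(\alpha,\beta)\in I}P_{\alpha\beta}$, a density matrix on $\mathbb{C}^4\otimes\mathbb{C}^4$. A state is separable if it is a convex combination of product states $\rho^1\otimes\rho^2$ (one factor on each $\mathbb{C}^4$), and entangled otherwise. A special quadruple is a subset $Q\subset L_{16}$ of exactly 4 points for which there exist unit vectors $|\varphi\rangle,|\psi\rangle\in\mathbb{C}^4$ with $\frac14\sum_{(\alpha,\beta)\in Q}|\langle\varphi|\sigma_{\alpha\beta}|\psi\rangle|^2=1$. *)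

theory Defs
  imports "HOL-Analysis.Analysis"
begin

text \<open>
  Tensor products are indexed by product types: \<open>\<complex>\<^sup>4 = \<complex>\<^sup>2 \<otimes> \<complex>\<^sup>2\<close> has index type \<open>2 \<times> 2\<close>,
  so that the canonical basis vectors \<open>|j\<rangle>\<close> are \<open>axis j 1\<close> for \<open>j :: 2 \<times> 2\<close>.
\<close>

type_synonym idx4 = "2 \<times> 2"

text \<open>The Hermitian inner product \<open>\<langle>x|y\<rangle>\<close>, conjugate-linear in the first argument
  (the library's \<open>inner\<close> on \<open>complex ^ 'n\<close> is only its real part).\<close>

definition cinner :: "complex ^ 'n \<Rightarrow> complex ^ 'n \<Rightarrow> complex" where
  "cinner x y = (\<Sum>i\<in>UNIV. cnj (x $ i) * y $ i)"

definition tensor_vec :: "complex ^ 'm \<Rightarrow> complex ^ 'n \<Rightarrow> complex ^ ('m \<times> 'n)" where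
  "tensor_vec x y = (\<chi> i. x $ fst i * y $ snd i)"

definition tensor_mat ::
  "complex ^ 'm ^ 'm \<Rightarrow> complex ^ 'n ^ 'n \<Rightarrow> complex ^ ('m \<times> 'n) ^ ('m \<times> 'n)" where
  "tensor_mat A B = (\<chi> i j. A $ fst i $ fst j * B $ snd i $ snd j)"

text \<open>The orthogonal projection \<open>|v\<rangle>\<langle>v| / \<parallel>v\<parallel>\<^sup>2\<close> onto the complex line spanned by \<open>v \<noteq> 0\<close>.\<close>

definition proj_onto :: "complex ^ 'n \<Rightarrow> complex ^ 'n ^ 'n" where
  "proj_onto v = (1 / (norm v)\<^sup>2) *\<^sub>R (\<chi> i j. v $ i * cnj (v $ j))"

text \<open>Only the arguments \<open>0, 1, 2, 3\<close> are meaningful.\<close>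

definition pauli :: "nat \<Rightarrow> complex ^ 2 ^ 2" where
  "pauli \<alpha> =
    (if \<alpha> = 0 then mat 1
     else if \<alpha> = 1 then vector [vector [0, 1], vector [1, 0]]
     else if \<alpha> = 2 then vector [vector [0, - \<i>], vector [\<i>, 0]]
     else vector [vector [1, 0], vector [0, - 1]])"

definition pauli2 :: "nat \<times> nat \<Rightarrow> complex ^ idx4 ^ idx4" where
  "pauli2 p = tensor_mat (pauli (fst p)) (pauli (snd p))"

definition L16 :: "(nat \<times> nat) set" where
  "L16 = {0..3} \<times> {0..3}"

definition Psi_plus :: "complex ^ (idx4 \<times> idx4)" where
  "Psi_plus = (1 / 2) *\<^sub>R (\<Sum>j\<in>UNIV. tensor_vec (axis j 1) (axis j 1))"

definition P_lattice :: "nat \<times> nat \<Rightarrow> complex ^ (idx4 \<times> idx4) ^ (idx4 \<times> idx4)" where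
  "P_lattice p = proj_onto (tensor_mat (mat 1) (pauli2 p) *v Psi_plus)"

definition lattice_state ::
  "(nat \<times> nat) set \<Rightarrow> complex ^ (idx4 \<times> idx4) ^ (idx4 \<times> idx4)" where
  "lattice_state I = (1 / real (card I)) *\<^sub>R (\<Sum>p\<in>I. P_lattice p)"

text \<open>Positive semidefiniteness includes that all \<open>\<langle>v|\<rho> v\<rangle>\<close> are real; over the complex
  numbers this already makes \<open>\<rho>\<close> Hermitian.\<close>

definition density_matrix :: "complex ^ 'n ^ 'n \<Rightarrow> bool" where
  "density_matrix \<rho> \<longleftrightarrow> (\<forall>v. cinner v (\<rho> *v v) \<in> \<real>\<^sub>\<ge>\<^sub>0) \<and> trace \<rho> = 1"

definition separable_state :: "complex ^ ('m::finite \<times> 'n::finite) ^ ('m \<times> 'n) \<Rightarrow> bool" where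
  "separable_state \<rho> \<longleftrightarrow>
    (\<exists>(n::nat) (w :: nat \<Rightarrow> real) (\<rho>1 :: nat \<Rightarrow> complex ^ 'm ^ 'm) (\<rho>2 :: nat \<Rightarrow> complex ^ 'n ^ 'n).
      (\<forall>k<n. 0 \<le> w k \<and> density_matrix (\<rho>1 k) \<and> density_matrix (\<rho>2 k)) \<and>
      (\<Sum>k<n. w k) = 1 \<and>
      \<rho> = (\<Sum>k<n. w k *\<^sub>R tensor_mat (\<rho>1 k) (\<rho>2 k)))"

definition entangled_state :: "complex ^ ('m::finite \<times> 'n::finite) ^ ('m \<times> 'n) \<Rightarrow> bool" where
  "entangled_state \<rho> \<longleftrightarrow> density_matrix \<rho> \<and> \<not> separable_state \<rho>"

definition special_quadruple :: "(nat \<times> nat) set \<Rightarrow> bool" where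
  "special_quadruple Q \<longleftrightarrow>
    Q \<subseteq> L16 \<and> card Q = 4 \<and>
    (\<exists>(\<phi> :: complex ^ idx4) (\<psi> :: complex ^ idx4).
      norm \<phi> = 1 \<and> norm \<psi> = 1 \<and>
      1 / 4 * (\<Sum>p\<in>Q. (cmod (cinner \<phi> (pauli2 p *v \<psi>)))\<^sup>2) = 1)"

end

(*
  Up to a factor, the overlap of a product vector x \<otimes> y with the lattice vector v_p is
  z p = <\<phi>| sigma_p \<psi>>, where \<phi> is the conjugate of x and \<psi> = y. If rho_I is separable, then some
  product vector has z p0 \<noteq> 0 but z q = 0 for all q outside I, so it suffices to find a special
  quadruple through p0 on which z does not vanish. After multiplying \<psi> by sigma_p0 we may take
  p0 = (0,0). For the five pairwise anticommuting labels g = 10, 20, 31, 32, 33, a Fierz identity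
  says that z00^2 is the sum of the z_g^2, so z_g \<noteq> 0 for some g. A second identity writes
  z00 z_g as a signed sum of z_a z_b over the three commuting pairs with a + b = g, so some pair
  has z_a, z_b, z_(a+b) all nonzero. Finally {0, a, b, a + b} is special, because sigma_a and
  sigma_b have a common eigenvector.
*)

theory Submission
  imports Defs
begin

section \<open>Hermitian forms\<close>

lemma cinner_cnj: "cnj (cinner x y) = cinner y x"
  by (simp add: cinner_def mult.commute)

lemma cinner_add: "cinner x (y + z) = cinner x y + cinner x z"
  "cinner (x + y) z = cinner x z + cinner y z"
  by (simp_all add: cinner_def algebra_simps sum.distrib)

lemma cinner_scale: "cinner x (c *s y) = c * cinner x y" "cinner (c *s x) y = cnj c * cinner x y"
  by (simp_all add: cinner_def sum_distrib_left ac_simps)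

lemma cinner_sum_right: "cinner x (\<Sum>k\<in>K. f k) = (\<Sum>k\<in>K. cinner x (f k))"
  by (induction K rule: infinite_finite_induct) (simp_all add: cinner_add, simp_all add: cinner_def)

lemma cinner_axis: "cinner (axis i 1) y = y $ i"
  unfolding cinner_def axis_def by (simp add: if_distrib[of cnj]
      if_distrib[of "\<lambda>x. x * _"] cong: if_cong)

lemma cinner_self: "cinner x x = of_real ((norm x)\<^sup>2)"
proof -
  have "(norm x)\<^sup>2 = (\<Sum>i\<in>UNIV. (cmod (x $ i))\<^sup>2)"
    by (simp add: norm_vec_def L2_set_def sum_nonneg)
  then show ?thesis
    by (simp add: cinner_def complex_norm_square mult.commute del: of_real_power)
qed

lemma cinner_adjoint:
  assumes "\<And>i j. cnj (A $ i $ j) = B $ j $ i"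
  shows "cinner (A *v x) y = cinner x (B *v y)"
  unfolding cinner_def matrix_vector_mult_def
  by (simp add: assms sum_distrib_left sum_distrib_right ac_simps) (rule sum.swap)

lemma quadratic_form_sum: "cinner u ((\<Sum>k\<in>K. A k) *v u) = (\<Sum>k\<in>K. cinner u (A k *v u))"
proof -
  have "(\<Sum>k\<in>K. A k) *v u = (\<Sum>k\<in>K. A k *v u)"
    by (induction K rule: infinite_finite_induct) (simp_all add: matrix_vector_mult_add_rdistrib)
  then show ?thesis by (simp add: cinner_sum_right)
qed

lemma quadratic_form_scaleR: "cinner u ((r *\<^sub>R A) *v u) = of_real r * cinner u (A *v u)"
  by (simp add: cinner_def matrix_vector_mult_def sum_distrib_left ac_simps
      scaleR_conv_of_real[where 'a=complex])

lemma mult_axis_component: "(A *v axis j (1::complex)) $ i = A $ i $ j"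
  by (simp add: matrix_vector_mult_def axis_def if_distrib[of "\<lambda>x. _ * x"] cong: if_cong)

text \<open>Vectors supported on two coordinates already detect hermiticity and the effect of a zero
  diagonal entry.\<close>

lemma quadratic_form_two_axes:
  "cinner (axis i 1 + t *s axis j 1) (A *v (axis i 1 + t *s axis j 1))
    = A $ i $ i + t * A $ i $ j + cnj t * A $ j $ i + cnj t * t * A $ j $ j"
  by (simp add: matrix_vector_right_distrib vector_scalar_commute cinner_add cinner_scale cinner_axis
      mult_axis_component algebra_simps)

lemma matrix_mult_scaleR: "A *v (r *\<^sub>R x) = r *\<^sub>R (A *v x)" for A :: "complex ^ 'n ^ 'm"
  by (simp add: vec_eq_iff matrix_vector_mult_def scaleR_sum_right)

text \<open>The group sum \<open>C\<close> = 1 + A + B + AB absorbs \<open>A\<close> and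
  \<open>B\<close> from the left, so every vector \<open>C *v v\<close> is fixed by both. Its last
  three summands have trace zero, hence \<open>C\<close> has trace \<open>CARD('n')\<close> and is
  not zero.\<close>

lemma joint_fixed_vector:
  fixes A B :: "complex ^ 'n ^ 'n"
  assumes "A ** A = mat 1" "B ** B = mat 1" "A ** B = B ** A"
    and "trace A = 0" "trace B = 0" "trace (A ** B) = 0"
  obtains x where "norm x = 1" "A *v x = x" "B *v x = x"
proof -
  define C where "C = mat 1 + A + B + A ** B"
  have tr: "trace C = of_nat CARD('n)"
    unfolding C_def trace_add using assms(4-6) by (simp add: trace_def mat_def)
  have "C \<noteq> 0" using tr by (auto simp: trace_def)
  then obtain v where v: "C *v v \<noteq> 0"
    by (metis matrix_eq matrix_vector_mult_0)
  have "A ** C = C"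
    unfolding C_def by (simp add: matrix_add_ldistrib matrix_mul_assoc assms(1) add_ac)
  moreover have "B ** C = C"
    unfolding C_def using assms(2,3)
    by (simp add: matrix_add_ldistrib) (metis (no_types, lifting) ab_semigroup_add_class.add_ac
          matrix_mul_assoc matrix_mul_rid)
  ultimately have *: "A *v (C *v v) = C *v v" "B *v (C *v v) = C *v v"
    by (simp_all add: matrix_vector_mul_assoc)
  show ?thesis
    by (rule that[of "(1 / norm (C *v v)) *\<^sub>R (C *v v)"])
      (use v * in \<open>simp_all add: matrix_mult_scaleR\<close>)
qed

section \<open>Positive semidefinite matrices and separability\<close>

lemma tensor_mat_mult:
  "tensor_mat A B ** tensor_mat C D = tensor_mat (A ** C) (B ** D)"
  by (simp add: vec_eq_iff tensor_mat_def matrix_matrix_mult_def sum_product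
      sum.cartesian_product ac_simps flip: UNIV_Times_UNIV)
     (simp add: case_prod_beta)

lemma trace_tensor_mat: "trace (tensor_mat A B) = trace A * trace B"
  by (simp add: trace_def tensor_mat_def sum_product sum.cartesian_product case_prod_beta
      flip: UNIV_Times_UNIV)

lemma tensor_mat_one: "tensor_mat (mat 1) (mat 1) = mat 1"
  by (auto simp: vec_eq_iff tensor_mat_def mat_def prod_eq_iff)

lemma tensor_mat_minus: "tensor_mat (- A) (- B) = tensor_mat A B"
  by (simp add: tensor_mat_def)

lemma tensor_mat_sum:
  "tensor_mat (\<Sum>k\<in>K. A k) (\<Sum>l\<in>L. B l) = (\<Sum>k\<in>K. \<Sum>l\<in>L. tensor_mat (A k) (B l))"
  by (simp add: vec_eq_iff tensor_mat_def sum_product)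

text \<open>The positivity clause of \<open>density_matrix\<close> without the trace, because the
  remainders in the rank-one decomposition are not normalised.\<close>

definition psd :: "complex ^ 'n ^ 'n \<Rightarrow> bool" where
  "psd A \<longleftrightarrow> (\<forall>v. cinner v (A *v v) \<in> \<real>\<^sub>\<ge>\<^sub>0)"

definition outer :: "complex ^ 'n \<Rightarrow> complex ^ 'n ^ 'n" where
  "outer x = (\<chi> i j. x $ i * cnj (x $ j))"

lemma cinner_outer: "cinner u (outer x *v u) = of_real ((cmod (cinner u x))\<^sup>2)"
proof -
  have "cinner u (outer x *v u) = cinner u x * cinner x u"
    by (simp add: cinner_def outer_def matrix_vector_mult_def sum_product sum_distrib_left ac_simps)
  also have "\<dots> = cinner u x * cnj (cinner u x)" by (simp add: cinner_cnj)
  finally show ?thesis by (simp only: complex_norm_square)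
qed

lemma trace_outer: "trace (outer x) = cinner x x"
  by (simp add: trace_def outer_def cinner_def mult.commute)

lemma tensor_mat_outer: "tensor_mat (outer x) (outer y) = outer (tensor_vec x y)"
  by (simp add: vec_eq_iff tensor_mat_def outer_def tensor_vec_def)

section \<open>Rank-one decomposition of positive semidefinite matrices\<close>

lemma psd_hermitian:
  assumes "psd A"
  shows "A $ j $ i = cnj (A $ i $ j)"
proof -
  have re: "Im (A $ i $ i + t * A $ i $ j + cnj t * A $ j $ i + cnj t * t * A $ j $ j) = 0" for i j t
    using assms unfolding psd_def quadratic_form_two_axes[symmetric]
    by (metis complex_nonneg_Reals_iff)
  have d: "Im (A $ i $ i) = 0" for i using re[of i 0 i] by simp
  \<comment> \<open>t = 1 compares the imaginary parts of the two off-diagonal entries, t = \<i>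
    their real parts.\<close>
  show ?thesis using re[of i 1 j] re[of i \<i> j] d[of i] d[of j]
    by (simp add: complex_eq_iff)
qed

lemma psd_diag:
  assumes "psd A" shows "A $ i $ i = of_real (Re (A $ i $ i))" "Re (A $ i $ i) \<ge> 0"
proof -
  have "cinner (axis i 1) (A *v axis i 1) \<in> \<real>\<^sub>\<ge>\<^sub>0" using assms by (simp add: psd_def)
  then show "A $ i $ i = of_real (Re (A $ i $ i))" "Re (A $ i $ i) \<ge> 0"
    by (simp_all add: cinner_axis mult_axis_component complex_nonneg_Reals_iff complex_eq_iff)
qed

lemma psd_zero_diag:
  assumes "psd A" "A $ i $ i = 0"
  shows "A $ i $ j = 0"
proof (rule ccontr)
  assume nz: "A $ i $ j \<noteq> 0"
  define r where "r = Re (A $ j $ j)"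
  \<comment> \<open>The choice makes s |A_ij|^2 = -(r + 1), so the form at e_j + t e_i is r - 2(r +
    1) = -r - 2, which is negative.\<close>
  define s where "s = - (r + 1) / (cmod (A $ i $ j))\<^sup>2"
  define t where "t = complex_of_real s * A $ i $ j"
  have r: "A $ j $ j = of_real r" "r \<ge> 0" using psd_diag[OF assms(1)] by (simp_all add: r_def)
  have m: "A $ i $ j * A $ j $ i = of_real ((cmod (A $ i $ j))\<^sup>2)"
    by (simp only: psd_hermitian[OF assms(1), of j i] complex_norm_square)
  have "s * (cmod (A $ i $ j))\<^sup>2 = - (r + 1)" using nz by (simp add: s_def)
  then have sm: "of_real s * (A $ i $ j * A $ j $ i) = - (of_real r + 1)"
    unfolding m by (metis of_real_1 of_real_add of_real_minus of_real_mult)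
  have "A $ j $ j + t * A $ j $ i + cnj t * A $ i $ j + cnj t * t * A $ i $ i = of_real (- r - 2)"
  proof -
    have "A $ j $ j + t * A $ j $ i + cnj t * A $ i $ j + cnj t * t * A $ i $ i
        = of_real r + 2 * (of_real s * (A $ i $ j * A $ j $ i))"
      unfolding t_def by (simp add: r assms(2) psd_hermitian[OF assms(1), of j i, symmetric] algebra_simps)
    also have "\<dots> = of_real (- r - 2)" unfolding sm by simp
    finally show ?thesis .
  qed
  then have "complex_of_real (- r - 2) \<in> \<real>\<^sub>\<ge>\<^sub>0"
    using assms(1) unfolding psd_def quadratic_form_two_axes[symmetric] by metis
  then show False using r(2) by (simp add: complex_nonneg_Reals_iff)
qed

text \<open>Subtracting the rank-one part of a Schur complement annihilates one nonzero diagonal entry,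
  keeps the zero ones, and preserves positivity.\<close>

lemma psd_sum_outer:
  assumes "psd A"
  shows "\<exists>(n::nat) f. A = (\<Sum>k<n. outer (f k))"
  using assms
proof (induction "card {i. A $ i $ i \<noteq> 0}" arbitrary: A rule: less_induct)
  case less
  show ?case
  proof (cases "\<exists>i. A $ i $ i \<noteq> 0")
    case False
    then have "A = 0" using psd_zero_diag[OF less.prems] by (simp add: vec_eq_iff)
    then have "A = (\<Sum>k<(0::nat). outer (undefined k))" by simp
    then show ?thesis by blast
  next
    case True
    then obtain i where i: "A $ i $ i \<noteq> 0" by blast
    define r where "r = Re (A $ i $ i)"
    have r: "A $ i $ i = of_real r" "r > 0"
      using psd_diag[OF less.prems, of i] i unfolding r_def
      by (auto simp: order_less_le)
    define x where "x = (\<chi> k. A $ k $ i / of_real (sqrt r))"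
    define B where "B = A - outer x"
    have herm: "A $ k $ j = cnj (A $ j $ k)" for j k using psd_hermitian[OF less.prems] .
    have Bc: "B $ k $ j = A $ k $ j - A $ k $ i * A $ i $ j / of_real r" for k j
      using r herm[of i j] by (simp add: B_def outer_def x_def flip: of_real_mult)
    have "psd B"
      unfolding psd_def
    proof
      fix v
      \<comment> \<open>The shift along axis i makes coordinate i of \<open>A *v w\<close> vanish.
        Then \<open>A *v w = B *v v\<close>, and the form of \<open>B\<close> at \<open>v\<close>
        equals the form of \<open>A\<close> at \<open>w\<close>.\<close>
      define c where "c = - (A *v v) $ i / of_real r"
      define w where "w = v + c *s axis i 1"
      have Bv: "(B *v v) $ k = (A *v v) $ k - A $ k $ i * (A *v v) $ i / of_real r" for k
        by (simp add: matrix_vector_mult_def Bc algebra_simps sum_subtractf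
            sum_divide_distrib sum_distrib_left)
      have "A *v w = B *v v"
        by (simp add: vec_eq_iff Bv w_def c_def matrix_vector_right_distrib
            matrix_vector_mult_diff_distrib vector_scalar_commute mult_axis_component)
      moreover have "(B *v v) $ i = 0" using r by (simp add: Bv)
      ultimately have "cinner w (A *v w) = cinner v (B *v v)"
        by (simp add: w_def cinner_add cinner_scale cinner_axis)
      then show "cinner v (B *v v) \<in> \<real>\<^sub>\<ge>\<^sub>0" using less.prems by (metis psd_def)
    qed
    moreover have "card {k. B $ k $ k \<noteq> 0} < card {k. A $ k $ k \<noteq> 0}"
    proof (rule psubset_card_mono)
      have "B $ i $ i = 0" using r by (simp add: Bc)
      moreover have "B $ k $ k = 0" if "A $ k $ k = 0" for k
        using psd_zero_diag[OF less.prems that] by (simp add: Bc)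
      ultimately show "{k. B $ k $ k \<noteq> 0} \<subset> {k. A $ k $ k \<noteq> 0}" using i by blast
    qed simp
    ultimately obtain n :: nat and f where "B = (\<Sum>k<n. outer (f k))"
      using less.hyps by blast
    then have "A = (\<Sum>k<Suc n. outer ((f(n := x)) k))"
      by (simp add: B_def algebra_simps)
    then show ?thesis by blast
  qed
qed

text \<open>Splitting both factors of every term into rank-one matrices turns the quadratic form of
  \<rho> into a sum of nonnegative terms, one for each product vector. A term that is nonzero at
  \<open>u\<close> selects the product vector; wherever the whole form vanishes, so does this
  term.\<close>

lemma separable_product_vector:
  assumes "separable_state \<rho>" and u: "cinner u (\<rho> *v u) \<noteq> 0"
  obtains x y where "cinner u (tensor_vec x y) \<noteq> 0"
    and "\<And>v. cinner v (\<rho> *v v) = 0 \<Longrightarrow> cinner v (tensor_vec x y) = 0"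
proof -
  obtain n w \<rho>1 \<rho>2 where *:
    "\<forall>k<(n::nat). 0 \<le> w k \<and> density_matrix (\<rho>1 k) \<and> density_matrix (\<rho>2 k)"
    and \<rho>: "\<rho> = (\<Sum>k<n. w k *\<^sub>R tensor_mat (\<rho>1 k) (\<rho>2 k))"
    using assms(1) unfolding separable_state_def by auto
  have "\<forall>k. \<exists>m f. k < n \<longrightarrow> \<rho>1 k = (\<Sum>a<(m::nat). outer (f a))"
    "\<forall>k. \<exists>m f. k < n \<longrightarrow> \<rho>2 k = (\<Sum>a<(m::nat). outer (f a))"
    using * psd_sum_outer unfolding density_matrix_def psd_def by blast+
  then obtain m1 m2 :: "nat \<Rightarrow> nat" and f1 f2 where
    f: "\<And>k. k < n \<Longrightarrow> \<rho>1 k = (\<Sum>a<m1 k. outer (f1 k a))"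
      "\<And>k. k < n \<Longrightarrow> \<rho>2 k = (\<Sum>a<m2 k. outer (f2 k a))"
    by metis
  define g where "g v k a b = w k * (cmod (cinner v (tensor_vec (f1 k a) (f2 k b))))\<^sup>2" for v k a b
  have form: "cinner v (\<rho> *v v) = of_real (\<Sum>k<n. \<Sum>a<m1 k. \<Sum>b<m2 k. g v k a b)" for v
    by (simp add: \<rho> f tensor_mat_sum tensor_mat_outer quadratic_form_sum quadratic_form_scaleR
        cinner_outer g_def sum_distrib_left)
  have g0: "g v k a b \<ge> 0" if "k < n" for v k a b using * that by (simp add: g_def)
  have "(\<Sum>k<n. \<Sum>a<m1 k. \<Sum>b<m2 k. g u k a b) \<noteq> 0"
    using u by (simp only: form of_real_eq_0_iff not_False_eq_True)
  then obtain k a b where k: "k < n" "a < m1 k" "b < m2 k" "g u k a b \<noteq> 0"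
    by (meson lessThan_iff sum.neutral)
  show ?thesis
  proof (rule that)
    show "cinner u (tensor_vec (f1 k a) (f2 k b)) \<noteq> 0" using k(4) by (auto simp: g_def)
    fix v assume "cinner v (\<rho> *v v) = 0"
    then have "(\<Sum>k<n. \<Sum>a<m1 k. \<Sum>b<m2 k. g v k a b) = 0" by (simp only: form of_real_eq_0_iff)
    then have "(\<Sum>a<m1 k. \<Sum>b<m2 k. g v k a b) = 0"
      using k(1) by (subst (asm) sum_nonneg_eq_0_iff) (auto intro!: sum_nonneg g0)
    then have "(\<Sum>b<m2 k. g v k a b) = 0"
      using k by (subst (asm) sum_nonneg_eq_0_iff) (auto intro!: sum_nonneg g0)
    then have "g v k a b = 0"
      using k by (subst (asm) sum_nonneg_eq_0_iff) (auto intro!: g0)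
    \<comment> \<open>Here \<open>k(4)\<close> gives \<open>w k\<close> \<noteq> 0, so the overlap
      itself must vanish.\<close>
    then show "cinner v (tensor_vec (f1 k a) (f2 k b)) = 0" using k(4) by (auto simp: g_def)
  qed
qed

section \<open>Pauli matrices and special quadruples\<close>

lemma le3_cases: "(a::nat) \<in> {0..3} \<Longrightarrow> a = 0 \<or> a = 1 \<or> a = 2 \<or> a = 3"
  by auto

lemma sum_idx4: "(\<Sum>i\<in>(UNIV::idx4 set). f i) = f (1,1) + f (1,2) + f (2,1) + f (2,2)"
  by (simp flip: UNIV_Times_UNIV add: sum.cartesian_product' UNIV_2 ac_simps)

lemma pauli_comp:
  "pauli a $ 1 $ 1 = (if a = 0 \<or> a \<notin> {0,1,2} then 1 else 0)"
  "pauli a $ 1 $ 2 = (if a = 1 then 1 else if a = 2 then - \<i> else 0)"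
  "pauli a $ 2 $ 1 = (if a = 1 then 1 else if a = 2 then \<i> else 0)"
  "pauli a $ 2 $ 2 = (if a = 0 then 1 else if a \<notin> {0,1,2} then - 1 else 0)"
  by (auto simp: pauli_def mat_def)

lemma trace_pauli_mult:
  assumes "a \<in> {0..3}" "b \<in> {0..3}"
  shows "trace (pauli a ** pauli b) = (if a = b then 2 else 0)"
  using le3_cases[OF assms(1)] le3_cases[OF assms(2)]
  by (elim disjE; simp add: trace_def matrix_matrix_mult_def sum_2 pauli_comp)

text \<open>Traces multiply over tensor factors. This orthogonality yields both the orthonormality
  of the lattice vectors and the vanishing traces needed for joint fixed vectors.\<close>

lemma trace_pauli2_mult:
  assumes "p \<in> L16" "q \<in> L16"
  shows "trace (pauli2 p ** pauli2 q) = (if p = q then 4 else 0)"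
proof -
  have "fst p \<in> {0..3}" "snd p \<in> {0..3}" "fst q \<in> {0..3}" "snd q \<in> {0..3}"
    using assms by (auto simp: L16_def)
  then show ?thesis
    by (simp add: pauli2_def tensor_mat_mult trace_tensor_mat trace_pauli_mult prod_eq_iff)
qed

lemma pauli2_zero: "pauli2 (0, 0) = mat 1"
  by (simp add: pauli2_def pauli_def tensor_mat_one)

lemma trace_pauli2:
  assumes "p \<in> L16" "p \<noteq> (0, 0)"
  shows "trace (pauli2 p) = 0"
  using trace_pauli2_mult[OF assms(1), of "(0,0)"] assms
  by (simp add: pauli2_zero L16_def)

lemma pauli_square: "pauli a ** pauli a = mat 1"
  by (auto simp: vec_eq_iff forall_2 matrix_matrix_mult_def sum_2 pauli_comp mat_def)

lemma pauli2_square: "pauli2 p ** pauli2 p = mat 1"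
  by (simp add: pauli2_def tensor_mat_mult pauli_square tensor_mat_one)

lemma pauli_hermitian: "cnj (pauli a $ i $ j) = pauli a $ j $ i"
  using exhaust_2[of i] exhaust_2[of j] by (auto simp: pauli_comp)

lemma pauli2_hermitian: "cnj (pauli2 p $ i $ j) = pauli2 p $ j $ i"
  by (simp add: pauli2_def tensor_mat_def pauli_hermitian)

text \<open>The labels form the group \<open>(\<int>/2)\<^sup>4\<close>; multiplying Pauli matrices adds labels, up to a phase.\<close>

definition pauli_add :: "nat \<times> nat \<Rightarrow> nat \<times> nat \<Rightarrow> nat \<times> nat" where
  "pauli_add p q = (Bit_Operations.xor (fst p) (fst q), Bit_Operations.xor (snd p) (snd q))"

section \<open>Products of Pauli matrices up to phase\<close>

lemma xor_le3:
  assumes "(a::nat) \<in> {0..3}" "b \<in> {0..3}"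
  shows "Bit_Operations.xor a b \<in> {0..3}"
  using le3_cases[OF assms(1)] le3_cases[OF assms(2)] by (elim disjE) simp_all

lemma pauli_add_in_L16: "p \<in> L16 \<Longrightarrow> q \<in> L16 \<Longrightarrow> pauli_add p q \<in> L16"
  using xor_le3[of "fst p" "fst q"] xor_le3[of "snd p" "snd q"]
  by (auto simp: L16_def pauli_add_def)

lemma pauli_add_right_cancel: "pauli_add p r = pauli_add q r \<longleftrightarrow> p = q"
proof -
  have "a = b" if "Bit_Operations.xor a c = Bit_Operations.xor b c" for a b c :: nat
  proof -
    have "Bit_Operations.xor (Bit_Operations.xor a c) c = Bit_Operations.xor (Bit_Operations.xor b c) c"
      using that by simp
    then show ?thesis by (simp add: xor.assoc)
  qed
  then show ?thesis by (auto simp: pauli_add_def prod_eq_iff)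
qed

lemma pauli_add_zero: "pauli_add (0, 0) p = p" "pauli_add p (0, 0) = p"
  by (simp_all add: pauli_add_def)

text \<open>On {0,1,2,3} exclusive or is the Klein four-group: it sends two distinct nonzero labels
  to the third.\<close>

lemma pauli_mult_phase:
  assumes "a \<in> {0..3}" "b \<in> {0..3}"
  shows "\<exists>c. cmod c = 1 \<and>
    (\<forall>i j. pauli (Bit_Operations.xor a b) $ i $ j = c * (pauli a ** pauli b) $ i $ j)"
proof -
  \<comment> \<open>The phase stands on the side of the product, so it is the inverse of the usual
    one: sigma_1 sigma_2 = \<i> sigma_3 gives -\<i>.\<close>
  let ?c = "if a = b \<or> a = 0 \<or> b = 0 then 1
    else if (a, b) \<in> {(1, 2), (2, 3), (3, 1)} then - \<i> else \<i>"
  have "cmod ?c = 1" by simp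
  moreover have "\<forall>i j. pauli (Bit_Operations.xor a b) $ i $ j = ?c * (pauli a ** pauli b) $ i $ j"
    using le3_cases[OF assms(1)] le3_cases[OF assms(2)]
    by (elim disjE; simp add: forall_2 matrix_matrix_mult_def sum_2 pauli_comp)
  ultimately show ?thesis by blast
qed

lemma pauli2_mult_phase:
  assumes "p \<in> L16" "q \<in> L16"
  obtains c where "cmod c = 1"
    "\<And>x. pauli2 (pauli_add p q) *v x = c *s (pauli2 p *v (pauli2 q *v x))"
proof -
  have "fst p \<in> {0..3}" "snd p \<in> {0..3}" "fst q \<in> {0..3}" "snd q \<in> {0..3}"
    using assms by (auto simp: L16_def)
  then obtain c d where c: "cmod c = 1" "cmod d = 1"
    "\<And>i j. pauli (Bit_Operations.xor (fst p) (fst q)) $ i $ j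
        = c * (pauli (fst p) ** pauli (fst q)) $ i $ j"
    "\<And>i j. pauli (Bit_Operations.xor (snd p) (snd q)) $ i $ j
        = d * (pauli (snd p) ** pauli (snd q)) $ i $ j"
    using pauli_mult_phase by meson
  have "pauli2 (pauli_add p q) $ i $ j = c * d * (pauli2 p ** pauli2 q) $ i $ j" for i j
    unfolding pauli2_def pauli_add_def tensor_mat_mult by (simp add: tensor_mat_def c)
  then have "pauli2 (pauli_add p q) *v x = (c * d) *s ((pauli2 p ** pauli2 q) *v x)" for x
    by (simp add: vec_eq_iff matrix_vector_mult_def sum_distrib_left ac_simps)
  with c(1,2) that[of "c * d"] show ?thesis
    by (simp add: norm_mult matrix_vector_mul_assoc)
qed

lemma cinner_pauli2: "cinner (pauli2 p *v x) (pauli2 p *v y) = cinner x y"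
  by (simp add: cinner_adjoint[OF pauli2_hermitian] matrix_vector_mul_assoc pauli2_square)

lemma norm_pauli2: "norm (pauli2 p *v x) = norm x"
proof -
  have "complex_of_real ((norm (pauli2 p *v x))\<^sup>2) = of_real ((norm x)\<^sup>2)"
    using cinner_pauli2[of p x x] by (simp only: cinner_self)
  then show ?thesis by (simp del: of_real_power)
qed

section \<open>Commuting Pauli products and special quadruples\<close>

lemma pauli_comm: "pauli a ** pauli b = pauli b ** pauli a" if "a = 0 \<or> b = 0 \<or> a = b"
  using that by (auto simp: pauli_def)

lemma pauli_anticommute:
  assumes "a \<in> {1..3}" "b \<in> {1..3}" "a \<noteq> b"
  shows "pauli a ** pauli b = - (pauli b ** pauli a)"
proof -
  have "a = 1 \<or> a = 2 \<or> a = 3" "b = 1 \<or> b = 2 \<or> b = 3" using assms by auto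
  with assms(3) show ?thesis
    by (elim disjE; simp add: vec_eq_iff forall_2 matrix_matrix_mult_def sum_2 pauli_comp)
qed

text \<open>Tensor products of Pauli matrices commute when both pairs of factors commute or both
  anticommute, since two signs cancel; hence the equality of truth values. It is the vanishing of
  the symplectic form on the label group.\<close>

definition symplectic_commute :: "nat \<times> nat \<Rightarrow> nat \<times> nat \<Rightarrow> bool" where
  "symplectic_commute p q \<longleftrightarrow>
    (fst p = 0 \<or> fst q = 0 \<or> fst p = fst q) = (snd p = 0 \<or> snd q = 0 \<or> snd p = snd q)"

lemma pauli2_commute:
  assumes "p \<in> L16" "q \<in> L16" "symplectic_commute p q"
  shows "pauli2 p ** pauli2 q = pauli2 q ** pauli2 p"
proof (cases "fst p = 0 \<or> fst q = 0 \<or> fst p = fst q")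
  case True
  with assms(3) have "snd p = 0 \<or> snd q = 0 \<or> snd p = snd q" by (simp add: symplectic_commute_def)
  with True show ?thesis
    by (simp add: pauli2_def tensor_mat_mult pauli_comm[of "fst p"] pauli_comm[of "snd p"])
next
  case False
  with assms(3) have "\<not> (snd p = 0 \<or> snd q = 0 \<or> snd p = snd q)" by (simp add: symplectic_commute_def)
  with False assms(1,2) have "pauli (fst p) ** pauli (fst q) = - (pauli (fst q) ** pauli (fst p))"
    "pauli (snd p) ** pauli (snd q) = - (pauli (snd q) ** pauli (snd p))"
    by (auto intro!: pauli_anticommute simp: L16_def)
  then show ?thesis
    by (simp add: pauli2_def tensor_mat_mult tensor_mat_minus)
qed

text \<open>The quadruple is the coset of the subgroup {0, a, b, a + b} through \<open>p\<close>. A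
  joint fixed vector of sigma_a and sigma_b is an eigenvector, with eigenvalue of modulus one, for
  the whole subgroup.\<close>

lemma special_quadruple_of_commuting:
  assumes p: "p \<in> L16" and a: "a \<in> L16" "a \<noteq> (0, 0)" and b: "b \<in> L16" "b \<noteq> (0, 0)"
    and ab: "a \<noteq> b" "pauli2 a ** pauli2 b = pauli2 b ** pauli2 a"
  shows "special_quadruple {p, pauli_add a p, pauli_add b p, pauli_add (pauli_add a b) p}"
proof -
  let ?V = "{(0, 0), a, b, pauli_add a b}"
  let ?Q = "(\<lambda>l. pauli_add l p) ` ?V"
  have Q: "?Q = {p, pauli_add a p, pauli_add b p, pauli_add (pauli_add a b) p}"
    by (simp add: pauli_add_zero)
  have "(0, 0) \<in> L16" by (simp add: L16_def)
  then have V: "?V \<subseteq> L16" using a b pauli_add_in_L16 by simp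
  then have "?Q \<subseteq> L16" using p pauli_add_in_L16 by auto
  moreover have "card ?Q = 4"
  proof -
    have "pauli_add a b \<noteq> a"
      using pauli_add_right_cancel[of b a "(0,0)"] b
      by (metis pauli_add_def pauli_add_right_cancel pauli_add_zero(1) xor.commute)
    moreover have "pauli_add a b \<noteq> b"
      using a by (metis pauli_add_right_cancel pauli_add_zero(1))
    moreover have "pauli_add a b \<noteq> (0, 0)"
      using ab(1) by (metis pauli_add_def pauli_add_right_cancel xor_self_eq)
    moreover note a(2) b(2) ab(1)
    ultimately have "distinct [(0, 0), a, b, pauli_add a b]"
      by (metis distinct_length_2_or_more distinct_singleton)
    then have "card ?V = 4" using distinct_card by fastforce
    moreover have "inj_on (\<lambda>l. pauli_add l p) ?V"
      by (intro inj_onI) (simp only: pauli_add_right_cancel)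
    ultimately show ?thesis using card_image by metis
  qed
  moreover
  \<comment> \<open>Orthogonality of distinct Pauli products supplies the three vanishing
    traces.\<close>
  obtain x where x: "norm x = 1" "pauli2 a *v x = x" "pauli2 b *v x = x"
    using joint_fixed_vector[of "pauli2 a" "pauli2 b"] pauli2_square trace_pauli2 a b ab
      trace_pauli2_mult[OF a(1) b(1)] by auto
  \<comment> \<open>Applying sigma_p to \<open>x\<close> undoes the translation by \<open>p\<close>:
    sigma_(l + p) maps \<open>y\<close> to sigma_l \<open>x\<close> up to a phase.\<close>
  define y where "y = pauli2 p *v x"
  have "(cmod (cinner x (pauli2 q *v y)))\<^sup>2 = 1" if q: "q \<in> ?Q" for q
  proof -
    obtain l where l: "l \<in> ?V" "q = pauli_add l p" using q by blast
    obtain c where c: "cmod c = 1" "pauli2 q *v y = c *s (pauli2 l *v (pauli2 p *v y))"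
      using pauli2_mult_phase[of l p] l V p by (metis (no_types, lifting) subsetD)
    have py: "pauli2 p *v y = x"
      by (simp add: y_def matrix_vector_mul_assoc pauli2_square)
    obtain d where d: "cmod d = 1" "pauli2 (pauli_add a b) *v x = d *s x"
      using pauli2_mult_phase[OF a(1) b(1)] x by metis
    have "\<exists>e. cmod e = 1 \<and> pauli2 l *v x = e *s x"
      using l(1) d x
      by (auto simp: pauli2_zero intro: exI[of _ 1])
    then obtain e where e: "cmod e = 1" "pauli2 l *v x = e *s x" by blast
    show ?thesis
      by (simp add: c py e cinner_scale(1) cinner_self norm_mult x)
  qed
  then have "1 / 4 * (\<Sum>q\<in>?Q. (cmod (cinner x (pauli2 q *v y)))\<^sup>2) = 1"
    using \<open>card ?Q = 4\<close> by simp
  moreover have "norm y = 1" by (simp add: y_def norm_pauli2 x)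
  ultimately show ?thesis unfolding special_quadruple_def Q using x(1) by blast
qed

section \<open>Quadratic relations between the overlaps\<close>

lemma pauli2_form:
  "cinner \<phi> (pauli2 p *v \<psi>) = (\<Sum>i\<in>UNIV. \<Sum>j\<in>UNIV. cnj (\<phi> $ i) *
     (pauli (fst p) $ fst i $ fst j * pauli (snd p) $ snd i $ snd j) * \<psi> $ j)"
  by (simp add: cinner_def matrix_vector_mult_def pauli2_def tensor_mat_def
      sum_distrib_left ac_simps)

text \<open>These express the vanishing of combinations of \<open>2 \<times> 2\<close> minors of the rank-one matrix
  \<open>|\<psi>\<rangle>\<langle>\<phi>|\<close> in its Pauli coordinates.\<close>

lemma pauli2_quadric_identities:
  fixes \<phi> \<psi> :: "complex ^ idx4"
  assumes z_def: "z = (\<lambda>a b. cinner \<phi> (pauli2 (a, b) *v \<psi>))"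
  shows "(z 0 0)\<^sup>2 = (z 1 0)\<^sup>2 + (z 2 0)\<^sup>2 + (z 3 1)\<^sup>2 + (z 3 2)\<^sup>2 + (z 3 3)\<^sup>2"
    and "z 0 0 * z 1 0 = z 0 1 * z 1 1 + z 0 2 * z 1 2 + z 0 3 * z 1 3"
    and "z 0 0 * z 2 0 = z 0 1 * z 2 1 + z 0 2 * z 2 2 + z 0 3 * z 2 3"
    and "z 0 0 * z 3 1 = z 0 1 * z 3 0 - z 1 2 * z 2 3 + z 1 3 * z 2 2"
    and "z 0 0 * z 3 2 = z 0 2 * z 3 0 + z 1 1 * z 2 3 - z 1 3 * z 2 1"
    and "z 0 0 * z 3 3 = z 0 3 * z 3 0 - z 1 1 * z 2 2 + z 1 2 * z 2 1"
proof -
  have i2: "\<i> * (\<i> * x) = - x" for x by (simp flip: mult.assoc)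
  \<comment> \<open>In coordinates each claim is a polynomial identity in the entries of \<psi> and
    the conjugated entries of \<phi>; \<open>i2\<close> removes squares of \<i>.\<close>
  note alg = z_def pauli2_form sum_idx4 pauli_comp power2_eq_square algebra_simps i2
  show "(z 0 0)\<^sup>2 = (z 1 0)\<^sup>2 + (z 2 0)\<^sup>2 + (z 3 1)\<^sup>2 + (z 3 2)\<^sup>2 + (z 3 3)\<^sup>2"
    by (simp add: alg)
  show "z 0 0 * z 1 0 = z 0 1 * z 1 1 + z 0 2 * z 1 2 + z 0 3 * z 1 3"
    by (simp add: alg)
  show "z 0 0 * z 2 0 = z 0 1 * z 2 1 + z 0 2 * z 2 2 + z 0 3 * z 2 3"
    by (simp add: alg)
  show "z 0 0 * z 3 1 = z 0 1 * z 3 0 - z 1 2 * z 2 3 + z 1 3 * z 2 2"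
    by (simp add: alg)
  show "z 0 0 * z 3 2 = z 0 2 * z 3 0 + z 1 1 * z 2 3 - z 1 3 * z 2 1"
    by (simp add: alg)
  show "z 0 0 * z 3 3 = z 0 3 * z 3 0 - z 1 1 * z 2 2 + z 1 2 * z 2 1"
    by (simp add: alg)
qed

text \<open>If every product z_a z_b z_(a+b) over commuting pairs vanished, multiplying each of the
  last five identities by its z_g would give z00 z_g^2 = 0 for all five g, and the first identity
  would force z00 = 0.\<close>

lemma nonvanishing_commuting_pair:
  fixes \<phi> \<psi> :: "complex ^ idx4"
  assumes "cinner \<phi> \<psi> \<noteq> 0"
  obtains a b where "a \<in> L16" "b \<in> L16" "a \<noteq> (0, 0)" "b \<noteq> (0, 0)" "a \<noteq> b"
    "symplectic_commute a b"
    and "cinner \<phi> (pauli2 a *v \<psi>) \<noteq> 0"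
    and "cinner \<phi> (pauli2 b *v \<psi>) \<noteq> 0"
    and "cinner \<phi> (pauli2 (pauli_add a b) *v \<psi>) \<noteq> 0"
proof -
  define z where "z = (\<lambda>a b. cinner \<phi> (pauli2 (a, b) *v \<psi>))"
  note id = pauli2_quadric_identities[OF z_def]
  have z0: "z 0 0 \<noteq> 0" using assms by (simp add: z_def pauli2_zero)
  define Z where "Z p = cinner \<phi> (pauli2 p *v \<psi>)" for p
  have zZ: "z a b = Z (a, b)" for a b by (simp add: z_def Z_def)
  have "\<exists>a\<in>L16. \<exists>b\<in>L16. a \<noteq> (0, 0) \<and> b \<noteq> (0, 0) \<and> a \<noteq> b \<and> symplectic_commute a b \<and>
      Z a * Z b * Z (pauli_add a b) \<noteq> 0"
  proof (rule ccontr)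
    assume "\<not> ?thesis"
    then have vanish: "z a1 a2 * z b1 b2 * z c1 c2 = 0"
      if "(a1, a2) \<in> L16" "(b1, b2) \<in> L16" "(a1, a2) \<noteq> (0, 0)" "(b1, b2) \<noteq> (0, 0)"
        "(a1, a2) \<noteq> (b1, b2)" "symplectic_commute (a1, a2) (b1, b2)"
        "(c1, c2) = pauli_add (a1, a2) (b1, b2)" for a1 a2 b1 b2 c1 c2
      using that unfolding zZ by metis
    \<comment> \<open>These triples are the nonzero elements of the fifteen isotropic subgroups of
      order four, three for each g; the factor for g stands last.\<close>
    have mem: "z 0 1 * z 1 1 * z 1 0 = 0" "z 0 2 * z 1 2 * z 1 0 = 0" "z 0 3 * z 1 3 * z 1 0 = 0"
      "z 0 1 * z 2 1 * z 2 0 = 0" "z 0 2 * z 2 2 * z 2 0 = 0" "z 0 3 * z 2 3 * z 2 0 = 0"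
      "z 0 1 * z 3 0 * z 3 1 = 0" "z 1 2 * z 2 3 * z 3 1 = 0" "z 1 3 * z 2 2 * z 3 1 = 0"
      "z 0 2 * z 3 0 * z 3 2 = 0" "z 1 1 * z 2 3 * z 3 2 = 0" "z 1 3 * z 2 1 * z 3 2 = 0"
      "z 0 3 * z 3 0 * z 3 3 = 0" "z 1 1 * z 2 2 * z 3 3 = 0" "z 1 2 * z 2 1 * z 3 3 = 0"
      by (rule vanish; simp add: L16_def symplectic_commute_def pauli_add_def)+
    have "z 0 0 * z 1 0 * z 1 0 = 0" "z 0 0 * z 2 0 * z 2 0 = 0" "z 0 0 * z 3 1 * z 3 1 = 0"
      "z 0 0 * z 3 2 * z 3 2 = 0" "z 0 0 * z 3 3 * z 3 3 = 0"
      unfolding id(2-6) distrib_right left_diff_distrib mem by simp_all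
    then have "z 1 0 = 0" "z 2 0 = 0" "z 3 1 = 0" "z 3 2 = 0" "z 3 3 = 0"
      using z0 by (simp_all del: One_nat_def)
    then show False using id(1) z0 by (simp del: One_nat_def)
  qed
  then show ?thesis using that by (auto simp: Z_def)
qed

text \<open>Replacing \<psi> by \<open>pauli2 p *v \<psi>\<close> moves \<open>p\<close> to the
  label (0, 0), where a nonvanishing commuting pair exists. Translating back changes the overlaps
  only by phases.\<close>

lemma special_quadruple_in_support:
  fixes \<phi> \<psi> :: "complex ^ idx4"
  assumes p: "p \<in> L16" and nz: "cinner \<phi> (pauli2 p *v \<psi>) \<noteq> 0"
  obtains Q where "special_quadruple Q" "p \<in> Q" "\<And>q. q \<in> Q \<Longrightarrow> cinner \<phi> (pauli2 q *v \<psi>) \<noteq> 0"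
proof -
  obtain a b where D: "a \<in> L16" "b \<in> L16" "a \<noteq> (0, 0)" "b \<noteq> (0, 0)" "a \<noteq> b"
    "symplectic_commute a b"
    and nz': "cinner \<phi> (pauli2 a *v (pauli2 p *v \<psi>)) \<noteq> 0"
    "cinner \<phi> (pauli2 b *v (pauli2 p *v \<psi>)) \<noteq> 0"
    "cinner \<phi> (pauli2 (pauli_add a b) *v (pauli2 p *v \<psi>)) \<noteq> 0"
    using nonvanishing_commuting_pair[OF nz] .
  have shift: "cinner \<phi> (pauli2 (pauli_add l p) *v \<psi>) \<noteq> 0"
    if "l \<in> L16" "cinner \<phi> (pauli2 l *v (pauli2 p *v \<psi>)) \<noteq> 0" for l
    using pauli2_mult_phase[OF that(1) p] that(2)
    by (metis cinner_scale(1) mult_eq_0_iff norm_zero zero_neq_one)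
  show ?thesis
  proof (rule that[OF special_quadruple_of_commuting[OF p D(1,3,2,4,5) pauli2_commute[OF D(1,2,6)]]])
    fix q assume "q \<in> {p, pauli_add a p, pauli_add b p, pauli_add (pauli_add a b) p}"
    then show "cinner \<phi> (pauli2 q *v \<psi>) \<noteq> 0"
      using nz shift[OF D(1) nz'(1)] shift[OF D(2) nz'(2)] shift[OF pauli_add_in_L16[OF D(1,2)] nz'(3)]
      by (elim insertE emptyE) simp_all
  qed simp
qed

section \<open>Lattice states\<close>

definition lattice_vec :: "nat \<times> nat \<Rightarrow> complex ^ (idx4 \<times> idx4)" where
  "lattice_vec p = tensor_mat (mat 1) (pauli2 p) *v Psi_plus"

lemma Psi_plus_component: "Psi_plus $ k = (if fst k = snd k then 1 / 2 else 0)"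
  by (auto simp: Psi_plus_def tensor_vec_def axis_def scaleR_conv_of_real[where 'a=complex]
      if_distrib[of "\<lambda>x. _ * x"]
      if_distrib[of "\<lambda>x. x * _"] cong: if_cong)

lemma sum_idx4_pair:
  fixes f :: "idx4 \<times> idx4 \<Rightarrow> complex"
  shows "(\<Sum>k\<in>UNIV. f k) = (\<Sum>i\<in>UNIV. \<Sum>j\<in>UNIV. f (i, j))"
  by (simp add: sum.cartesian_product flip: UNIV_Times_UNIV)

text \<open>\<open>Psi_plus\<close> is half the vectorised identity, so acting on its second factor
  vectorises the acting matrix, with indices swapped. Inner products of lattice vectors thereby
  become traces.\<close>

lemma lattice_vec_component: "lattice_vec p $ (i, j) = pauli2 p $ j $ i / 2"
  by (simp add: lattice_vec_def matrix_vector_mult_def tensor_mat_def mat_def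
      Psi_plus_component sum_idx4_pair if_distrib[of "\<lambda>x. _ * x"]
      if_distrib[of "\<lambda>x. x * _"] cong: if_cong
      flip: sum_divide_distrib)

lemma cinner_lattice_vec:
  assumes "p \<in> L16" "q \<in> L16"
  shows "cinner (lattice_vec p) (lattice_vec q) = (if p = q then 1 else 0)"
proof -
  have "cinner (lattice_vec p) (lattice_vec q) = trace (pauli2 p ** pauli2 q) / 4"
    by (simp add: cinner_def sum_idx4_pair lattice_vec_component pauli2_hermitian trace_def
        matrix_matrix_mult_def sum_divide_distrib)
  then show ?thesis by (simp only: trace_pauli2_mult[OF assms]) simp
qed

text \<open>The overlap is bilinear in \<open>x\<close> and \<open>y\<close>, whereas
  \<open>cinner\<close> is conjugate-linear on the left; this is why \<open>x\<close> is
  conjugated.\<close>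

lemma cinner_lattice_vec_tensor_vec:
  "cinner (lattice_vec p) (tensor_vec x y) = cinner (\<chi> i. cnj (x $ i)) (pauli2 p *v y) / 2"
  by (simp add: cinner_def sum_idx4_pair lattice_vec_component pauli2_hermitian tensor_vec_def
      matrix_vector_mult_def sum_distrib_left sum_divide_distrib ac_simps)

lemma P_lattice_outer:
  assumes "p \<in> L16"
  shows "P_lattice p = outer (lattice_vec p)"
proof -
  have "complex_of_real ((norm (lattice_vec p))\<^sup>2) = of_real 1"
    using cinner_lattice_vec[OF assms assms] by (simp only: cinner_self) simp
  then have "(norm (lattice_vec p))\<^sup>2 = 1" by (simp only: of_real_eq_iff)
  then show ?thesis by (simp add: P_lattice_def proj_onto_def outer_def flip: lattice_vec_def)
qed

lemma lattice_state_form: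
  assumes "I \<subseteq> L16"
  shows "cinner u (lattice_state I *v u) =
    of_real (1 / card I * (\<Sum>p\<in>I. (cmod (cinner u (lattice_vec p)))\<^sup>2))"
proof -
  have "(\<Sum>p\<in>I. P_lattice p) = (\<Sum>p\<in>I. outer (lattice_vec p))"
    using assms by (intro sum.cong) (auto simp: P_lattice_outer)
  then show ?thesis
    by (simp add: lattice_state_def quadratic_form_scaleR quadratic_form_sum cinner_outer)
qed

lemma density_matrix_lattice_state:
  assumes "I \<subseteq> L16" "I \<noteq> {}"
  shows "density_matrix (lattice_state I)"
  unfolding density_matrix_def
proof (intro conjI allI)
  show "cinner v (lattice_state I *v v) \<in> \<real>\<^sub>\<ge>\<^sub>0" for v
    unfolding lattice_state_form[OF assms(1)]
    by (simp add: sum_nonneg del: of_real_mult of_real_sum)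
  have fin: "finite I" using assms(1) finite_subset by (auto simp: L16_def)
  have "trace (\<Sum>p\<in>I. P_lattice p) = (\<Sum>p\<in>I. trace (P_lattice p))"
    by (simp add: trace_def) (rule sum.swap)
  also have "\<dots> = (\<Sum>p\<in>I. 1)"
    using assms(1) by (intro sum.cong) (auto simp: P_lattice_outer trace_outer cinner_lattice_vec)
  finally show "trace (lattice_state I) = 1"
    using fin assms(2) by (simp add: lattice_state_def trace_def scaleR_conv_of_real[where 'a=complex]
        flip: sum_divide_distrib)
qed

theorem theorem20:
  fixes I :: "(nat \<times> nat) set"
  assumes "I \<subseteq> L16" and "I \<noteq> {}"
    and "\<exists>p0\<in>I. \<not> (\<exists>Q. special_quadruple Q \<and> p0 \<in> Q \<and> Q \<subseteq> I)"
  shows "entangled_state (lattice_state I)"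
  unfolding entangled_state_def
proof (intro conjI notI)
  show "density_matrix (lattice_state I)" using density_matrix_lattice_state assms(1,2) .
  assume sep: "separable_state (lattice_state I)"
  obtain p where p: "p \<in> I" "\<nexists>Q. special_quadruple Q \<and> p \<in> Q \<and> Q \<subseteq> I" using assms(3) by blast
  have fin: "finite I" using assms(1) finite_subset by (auto simp: L16_def)
  \<comment> \<open>By orthonormality, the form at a lattice vector retains only the term of its own
    label.\<close>
  have form: "cinner (lattice_vec q) (lattice_state I *v lattice_vec q) =
      (if q \<in> I then of_real (1 / card I) else 0)" if "q \<in> L16" for q
  proof -
    have "(\<Sum>r\<in>I. (cmod (cinner (lattice_vec q) (lattice_vec r)))\<^sup>2) = (\<Sum>r\<in>I. if q = r then 1 else 0)"
      using assms(1) that by (intro sum.cong) (auto simp: cinner_lattice_vec)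
    then show ?thesis using fin by (simp add: lattice_state_form[OF assms(1)])
  qed
  have "cinner (lattice_vec p) (lattice_state I *v lattice_vec p) \<noteq> 0"
    using form[of p] p(1) assms(1) fin by auto
  then obtain x y where xy: "cinner (lattice_vec p) (tensor_vec x y) \<noteq> 0"
    "\<And>v. cinner v (lattice_state I *v v) = 0 \<Longrightarrow> cinner v (tensor_vec x y) = 0"
    using separable_product_vector[OF sep] by blast
  obtain Q where Q: "special_quadruple Q" "p \<in> Q"
    "\<And>q. q \<in> Q \<Longrightarrow> cinner (\<chi> i. cnj (x $ i)) (pauli2 q *v y) \<noteq> 0"
    using special_quadruple_in_support[of p "\<chi> i. cnj (x $ i)" y] xy(1) p(1) assms(1)
    by (auto simp: cinner_lattice_vec_tensor_vec)
  \<comment> \<open>The form vanishes at the lattice vectors of labels outside \<open>I\<close>, so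
    the product vector is orthogonal to them, while its overlaps over \<open>Q\<close> are
    nonzero.\<close>
  have "q \<in> I" if "q \<in> Q" for q
  proof (rule ccontr)
    assume "q \<notin> I"
    moreover have "q \<in> L16" using Q(1) that by (auto simp: special_quadruple_def)
    ultimately have "cinner (lattice_vec q) (tensor_vec x y) = 0" using xy(2) form by simp
    then show False using Q(3)[OF that] by (simp add: cinner_lattice_vec_tensor_vec)
  qed
  with Q p(2) show False by blast
qed

end
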